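(* For any integers $k \ge 0$ and $m \ge 0$, the number of ordered pairs of partitions $(\alpha,\beta)$ with $|\alpha|+|\beta|=m$ and $\ell(\alpha)+\ell(\beta)\le k$ is equal to the number of partitions of $m+\binom{k+1}{2}$ with $k$ corners whose diagrams do not contain the diagram of the staircase partition $\rho_{k+1}=(k+1,k,\ldots,1)$ of length $k+1$.
   Context: An integer partition is a finite weakly decreasing sequence of positive integers, called its parts; the empty sequence is allowed (it is the unique partition of $0$). The weight $|\lambda|$ of a partition $\lambda$ is the sum of its parts, $\lambda$ is a partition of $n$ if $|\lambda|=n$, and the length $\ell(\lambda)$ is the number of its parts (counted with multiplicity). The diagram of $\lambda=(\lambda_1,\lambda_2,\ldots)$ is the set of integer points $(i,j)$ with $1\le j\le \ell(\lambda)$ and $1\le i\le\lambda_j$. A corner of $\lambda$ is a point $(i,j)$ of its diagram such that neither $(i+1,j)$ nor $(i,j+1)$ is in the diagram. A partition with $k$ corners is one whose diagram has exactly $k$ corners; equivalently, its parts take exactly $k$ distinct values. "Contains" for diagrams means inclusion of sets of points. *)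

theory Defs
  imports Main
begin

definition is_partition :: "nat list \<Rightarrow> bool" where
  "is_partition xs \<longleftrightarrow> sorted_wrt (\<ge>) xs \<and> (\<forall>x\<in>set xs. 0 < x)"

abbreviation weight :: "nat list \<Rightarrow> nat" where
  "weight xs \<equiv> sum_list xs"

(* Points (i, j) are 1-based: i runs along row j, and the j-th part is "xs ! (j - 1)". *)
definition diagram :: "nat list \<Rightarrow> (nat \<times> nat) set" where
  "diagram xs = {(i, j). 1 \<le> j \<and> j \<le> length xs \<and> 1 \<le> i \<and> i \<le> xs ! (j - 1)}"

definition corners :: "nat list \<Rightarrow> (nat \<times> nat) set" where
  "corners xs = {(i, j). (i, j) \<in> diagram xs \<and> (i + 1, j) \<notin> diagram xs \<and> (i, j + 1) \<notin> diagram xs}"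

(* "staircase n = [n, n - 1, ..., 1]" *)
definition staircase :: "nat \<Rightarrow> nat list" where
  "staircase n = rev [1..<n + 1]"

lemma is_partition_staircase: "is_partition (staircase n)"
  by (auto simp: is_partition_def staircase_def sorted_wrt_rev simp del: upt_Suc)

lemma length_le_weight:
  assumes "is_partition xs"
  shows "length xs \<le> weight xs"
proof -
  have "\<forall>x\<in>set xs. 0 < x \<Longrightarrow> length xs \<le> weight xs"
    by (induction xs) auto
  with assms show ?thesis by (simp add: is_partition_def)
qed

(* The sets counted by "card" are finite: *)

lemma finite_partitions: "finite {xs. is_partition xs \<and> weight xs \<le> n}"
proof (rule finite_subset)
  show "{xs. is_partition xs \<and> weight xs \<le> n} \<subseteq> {xs. set xs \<subseteq> {..n} \<and> length xs \<le> n}"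
    using length_le_weight member_le_sum_list by fastforce
  show "finite {xs. set xs \<subseteq> {..n} \<and> length xs \<le> n}"
    by (rule finite_lists_length_le) simp
qed

lemma finite_partition_pairs:
  "finite {(a, b). is_partition a \<and> is_partition b \<and> weight a + weight b = m}"
  by (rule finite_subset [OF _ finite_cartesian_product [OF finite_partitions [of m] finite_partitions [of m]]])
    auto

lemma finite_diagram: "finite (diagram xs)"
proof (rule finite_subset)
  show "diagram xs \<subseteq> {..weight xs} \<times> {..length xs}"
  proof clarsimp
    fix i j assume "(i, j) \<in> diagram xs"
    then have "1 \<le> j" "j \<le> length xs" "i \<le> xs ! (j - 1)"
      by (auto simp: diagram_def)
    moreover from this have "xs ! (j - 1) \<le> weight xs"
      by (intro member_le_sum_list) auto
    ultimately show "i \<le> weight xs \<and> j \<le> length xs" by linarith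
  qed
qed simp

lemma finite_corners: "finite (corners xs)"
  by (rule finite_subset [OF _ finite_diagram [of xs]]) (auto simp: corners_def)

end

theory Submission
  imports Defs
begin

text \<open>
  Write the corners of \<open>\<mu>\<close> as \<open>(x\<^sub>j, y\<^sub>j)\<close> with \<open>x\<^sub>1 < \<dots> < x\<^sub>k\<close> and \<open>y\<^sub>1 > \<dots> > y\<^sub>k\<close>. Then
  \<open>x\<^sub>j \<ge> j\<close> and \<open>y\<^sub>j \<ge> k + 1 - j\<close>, and \<open>\<rho>\<^bsub>k+1\<^esub>\<close> is not contained in \<open>\<mu>\<close> iff for some \<open>i\<close> we have
  \<open>x\<^sub>j = j\<close> for \<open>j \<le> i\<close> and \<open>y\<^sub>j = k + 1 - j\<close> for \<open>j > i\<close>. Equivalently, \<open>\<mu>\<close> is \<open>\<rho>\<^sub>k\<close> with its first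
  \<open>i\<close> columns lengthened by the parts of \<open>\<alpha>\<close> and its first \<open>k - i\<close> rows lengthened by the parts of
  \<open>\<beta>\<close>. The first column of \<open>\<mu>\<close> has \<open>k + \<alpha>\<^sub>1\<close> points and the first row \<open>k + \<beta>\<^sub>1\<close>, so \<open>\<alpha>\<close> and \<open>\<beta>\<close> are
  recovered by peeling off columns as long as \<open>\<mu>\<close> has more rows than corners, and then rows.
\<close>

text \<open>The default 0 past the end lets row conditions be inequalities between values, with no
  case distinction on the length.\<close>

definition part_at :: "nat list \<Rightarrow> nat \<Rightarrow> nat" where
  "part_at xs j = (if j < length xs then xs ! j else 0)"

lemma part_at_Nil [simp]: "part_at [] j = 0"
  and part_at_Cons_0 [simp]: "part_at (x # xs) 0 = x"
  and part_at_Cons_Suc [simp]: "part_at (x # xs) (Suc j) = part_at xs j"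
  by (auto simp: part_at_def)

lemma is_partition_Nil [simp]: "is_partition []"
  by (simp add: is_partition_def)

lemma is_partition_Cons:
  "is_partition (x # xs) \<longleftrightarrow> 0 < x \<and> part_at xs 0 \<le> x \<and> is_partition xs"
  by (cases xs) (auto simp: is_partition_def)

lemma part_at_0_eq_0_iff: "is_partition xs \<Longrightarrow> part_at xs 0 = 0 \<longleftrightarrow> xs = []"
  by (cases xs) (auto simp: is_partition_Cons)

lemma part_at_pos_iff: "is_partition xs \<Longrightarrow> 0 < part_at xs j \<longleftrightarrow> j < length xs"
  by (auto simp: is_partition_def part_at_def)

lemma part_at_antimono: "is_partition xs \<Longrightarrow> i \<le> j \<Longrightarrow> part_at xs j \<le> part_at xs i"
  by (cases "i = j") (auto simp: is_partition_def part_at_def sorted_wrt_iff_nth_less)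

lemma le_part_at_0: "is_partition xs \<Longrightarrow> x \<in> set xs \<Longrightarrow> x \<le> part_at xs 0"
  by (cases xs) (auto simp: is_partition_def)

section \<open>Diagrams and corners in terms of parts\<close>

lemma mem_diagram_iff: "(i, j) \<in> diagram xs \<longleftrightarrow> 1 \<le> i \<and> 1 \<le> j \<and> i \<le> part_at xs (j - 1)"
  by (auto simp: diagram_def part_at_def)

lemma mem_corners_iff:
  "(i, Suc j) \<in> corners xs \<longleftrightarrow> 0 < i \<and> part_at xs j = i \<and> part_at xs (Suc j) < i"
  by (auto simp: corners_def mem_diagram_iff)

text \<open>Each value that occurs as a part has exactly one corner, at the end of the last row of
  that length, so \<open>fst\<close> maps corners bijectively onto values.\<close>

lemma card_corners:
  assumes "is_partition xs"
  shows "card (corners xs) = card (set xs)"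
proof -
  have "inj_on fst (corners xs)"
  proof (rule inj_onI, clarsimp)
    fix i j j' assume c: "(i, j) \<in> corners xs" "(i, j') \<in> corners xs"
    then obtain l l' where [simp]: "j = Suc l" "j' = Suc l'"
      by (cases j; cases j') (auto simp: corners_def mem_diagram_iff)
    \<comment> \<open>All rows after a corner are strictly shorter than its row, so two different
      rows of equal length cannot both end in a corner.\<close>
    have "\<not> l < l'" "\<not> l' < l"
      using c part_at_antimono [OF assms, of "Suc l" l'] part_at_antimono [OF assms, of "Suc l'" l]
      by (auto simp: mem_corners_iff)
    then show "j = j'" by simp
  qed
  moreover have "fst ` corners xs = set xs"
  proof (intro set_eqI iffI)
    fix v assume "v \<in> fst ` corners xs"
    then obtain j where v: "(v, j) \<in> corners xs" by auto
    then obtain l where "j = Suc l"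
      by (cases j) (auto simp: corners_def mem_diagram_iff)
    with v have "0 < v" "part_at xs l = v" by (auto simp: mem_corners_iff)
    then show "v \<in> set xs"
      by (auto simp: part_at_def split: if_splits)
  next
    fix v assume v: "v \<in> set xs"
    let ?J = "{j. j < length xs \<and> xs ! j = v}"
    have J: "finite ?J" "?J \<noteq> {}" using v by (auto simp: in_set_conv_nth)
    define j where "j = Max ?J"
    have "j \<in> ?J" unfolding j_def by (rule Max_in [OF J])
    then have j: "part_at xs j = v" by (simp add: part_at_def)
    have v0: "0 < v" using v assms by (auto simp: is_partition_def)
    have "part_at xs (Suc j) \<noteq> v"
    proof
      assume "part_at xs (Suc j) = v"
      then have "Suc j \<in> ?J" using v0 by (auto simp: part_at_def split: if_splits)
      then show False using Max_ge [OF J(1)] unfolding j_def by fastforce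
    qed
    then have "(v, Suc j) \<in> corners xs"
      using part_at_antimono [OF assms, of j "Suc j"] j v0 by (auto simp: mem_corners_iff)
    then show "v \<in> fst ` corners xs" by force
  qed
  ultimately show ?thesis by (metis card_image)
qed

section \<open>Containment of staircases\<close>

definition has_staircase :: "nat \<Rightarrow> nat list \<Rightarrow> bool" where
  "has_staircase n xs \<longleftrightarrow> (\<forall>j<n. n - j \<le> part_at xs j)"

lemma part_at_staircase: "part_at (staircase n) j = n - j"
  by (auto simp: part_at_def staircase_def rev_nth simp del: upt_Suc)

lemma diagram_staircase_subset_iff:
  "diagram (staircase n) \<subseteq> diagram xs \<longleftrightarrow> has_staircase n xs"
proof
  assume sub: "diagram (staircase n) \<subseteq> diagram xs"
  show "has_staircase n xs"
    unfolding has_staircase_def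
  proof (intro allI impI)
    fix j assume "j < n"
    \<comment> \<open>The last point of the row suffices, since its membership bounds the whole
      part.\<close>
    then have "(n - j, Suc j) \<in> diagram (staircase n)"
      by (simp add: mem_diagram_iff part_at_staircase)
    with sub have "(n - j, Suc j) \<in> diagram xs" by blast
    then show "n - j \<le> part_at xs j" by (simp add: mem_diagram_iff)
  qed
next
  assume stair: "has_staircase n xs"
  show "diagram (staircase n) \<subseteq> diagram xs"
  proof clarify
    fix i j assume "(i, j) \<in> diagram (staircase n)"
    then have "1 \<le> i" "1 \<le> j" "i \<le> n - (j - 1)"
      by (auto simp: mem_diagram_iff part_at_staircase)
    moreover from this have "j - 1 < n" by linarith
    with stair have "n - (j - 1) \<le> part_at xs (j - 1)"
      unfolding has_staircase_def by blast
    ultimately show "(i, j) \<in> diagram xs" by (simp add: mem_diagram_iff)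
  qed
qed

text \<open>The largest part is at least the number of distinct parts, and removing it loses at most
  one value.\<close>

lemma has_staircase_card_set: "is_partition xs \<Longrightarrow> has_staircase (card (set xs)) xs"
proof (induction xs)
  case Nil
  then show ?case by (simp add: has_staircase_def)
next
  case (Cons x xs)
  then have IH: "has_staircase (card (set xs)) xs" by (simp add: is_partition_Cons)
  have "set (x # xs) \<subseteq> {1..x}"
    using Cons.prems by (auto simp: is_partition_def)
  then have x: "card (set (x # xs)) \<le> x"
    using card_mono [of "{1..x}"] by (metis card_atLeastAtMost diff_Suc_1 finite_atLeastAtMost)
  have le: "card (set (x # xs)) \<le> Suc (card (set xs))"
    by (simp add: card_insert_if)
  show ?case
    unfolding has_staircase_def
  proof (intro allI impI)
    fix j assume j: "j < card (set (x # xs))"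
    show "card (set (x # xs)) - j \<le> part_at (x # xs) j"
    proof (cases j)
      case 0
      with x show ?thesis by simp
    next
      case (Suc l)
      with j le have "l < card (set xs)" by linarith
      with IH have "card (set xs) - l \<le> part_at xs l" by (simp add: has_staircase_def)
      with Suc le show ?thesis by simp
    qed
  qed
qed

section \<open>Removing and adding a first column\<close>

definition del_column :: "nat list \<Rightarrow> nat list" where
  "del_column xs = map (\<lambda>x. x - 1) (filter (\<lambda>x. x \<noteq> 1) xs)"

text \<open>The new first column has height \<open>n\<close>, provided that \<open>length xs \<le> n\<close>.\<close>

definition add_column :: "nat \<Rightarrow> nat list \<Rightarrow> nat list" where
  "add_column n xs = map Suc xs @ replicate (n - length xs) 1"

lemma sorted_wrt_ge_replicate: "sorted_wrt (\<ge>) (replicate n (x :: nat))"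
  by (induction n) auto

lemma is_partition_add_column: "is_partition xs \<Longrightarrow> is_partition (add_column n xs)"
  by (auto simp: is_partition_def add_column_def sorted_wrt_append sorted_wrt_map
      sorted_wrt_ge_replicate)

lemma length_add_column: "length xs \<le> n \<Longrightarrow> length (add_column n xs) = n"
  by (simp add: add_column_def)

lemma weight_add_column: "length xs \<le> n \<Longrightarrow> weight (add_column n xs) = weight xs + n"
  by (simp add: add_column_def sum_list_Suc sum_list_replicate)

text \<open>A strictly taller new column creates rows of a single point; their value 1 differs from
  all the shifted parts, which are at least 2.\<close>

lemma card_set_add_column:
  assumes "is_partition xs" "length xs < n"
  shows "card (set (add_column n xs)) = Suc (card (set xs))"
proof -
  have "set (add_column n xs) = insert 1 (Suc ` set xs)"
    using assms(2) by (auto simp: add_column_def)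
  moreover have "1 \<notin> Suc ` set xs" using assms(1) by (auto simp: is_partition_def)
  ultimately show ?thesis by (simp add: card_image)
qed

lemma del_column_add_column: "is_partition xs \<Longrightarrow> del_column (add_column n xs) = xs"
  by (induction xs) (simp_all add: is_partition_Cons del_column_def add_column_def)

text \<open>The ones that are filtered out stand at the end of a partition, so no index shifts, and
  truncated subtraction supplies the zeros there.\<close>

lemma part_at_del_column: "is_partition xs \<Longrightarrow> part_at (del_column xs) j = part_at xs j - 1"
proof (induction xs arbitrary: j)
  case Nil
  then show ?case by (simp add: del_column_def)
next
  case (Cons x xs)
  then have xs: "is_partition xs" "part_at xs 0 \<le> x" by (auto simp: is_partition_Cons)
  show ?case
  proof (cases "x = 1")
    case True
    then have "part_at xs l \<le> 1" for l
      using xs part_at_antimono [OF xs(1), of 0 l] by simp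
    moreover have "del_column (x # xs) = del_column xs" using True by (simp add: del_column_def)
    ultimately show ?thesis
      using Cons.IH [OF xs(1), of j] True by (cases j) (simp_all add: le_diff_conv)
  next
    case False
    then have "del_column (x # xs) = (x - 1) # del_column xs" by (simp add: del_column_def)
    then show ?thesis using Cons.IH [OF xs(1)] by (cases j) simp_all
  qed
qed

lemma is_partition_del_column: "is_partition xs \<Longrightarrow> is_partition (del_column xs)"
proof (induction xs)
  case (Cons x xs)
  then have xs: "is_partition xs" "part_at xs 0 \<le> x" "0 < x" by (auto simp: is_partition_Cons)
  then show ?case
    using Cons.IH part_at_del_column [OF xs(1), of 0]
    by (cases "x = 1") (auto simp: del_column_def is_partition_Cons)
qed (simp add: del_column_def)

lemma add_column_del_column: "is_partition xs \<Longrightarrow> add_column (length xs) (del_column xs) = xs"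
proof (induction xs)
  case (Cons x xs)
  then have xs: "is_partition xs" "part_at xs 0 \<le> x" "0 < x" by (auto simp: is_partition_Cons)
  have IH: "add_column (length xs) (del_column xs) = xs" using Cons.IH xs(1) .
  show ?case
  proof (cases "x = 1")
    case True
    have "\<forall>y\<in>set xs. y = 1"
      using le_part_at_0 [OF xs(1)] xs True by (fastforce simp: is_partition_def)
    then have "del_column xs = []" by (auto simp: del_column_def filter_empty_conv)
    then show ?thesis using IH True by (simp add: add_column_def del_column_def)
  next
    case False
    then have "del_column (x # xs) = (x - 1) # del_column xs" by (simp add: del_column_def)
    then show ?thesis using IH xs(3) by (simp add: add_column_def)
  qed
qed (simp add: add_column_def del_column_def)

lemma card_set_del_column:
  assumes "is_partition xs"
  shows "card (set (del_column xs)) = card (set xs - {1})"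
proof -
  have "set (del_column xs) = (\<lambda>x. x - 1) ` (set xs - {1})"
    by (auto simp: del_column_def)
  moreover have "inj_on (\<lambda>x. x - 1) (set xs - {1})"
    using assms by (auto simp: inj_on_def is_partition_def)
  ultimately show ?thesis by (simp add: card_image)
qed

text \<open>A staircase without its first column is the next smaller staircase, and its first column
  fits iff there are enough rows.\<close>

lemma has_staircase_Suc_iff:
  assumes "is_partition xs"
  shows "has_staircase (Suc n) xs \<longleftrightarrow> n < length xs \<and> has_staircase n (del_column xs)"
proof -
  have "has_staircase (Suc n) xs \<longleftrightarrow>
      1 \<le> part_at xs n \<and> (\<forall>j<n. Suc n - j \<le> part_at xs j)"
    by (auto simp: has_staircase_def less_Suc_eq)
  also have "1 \<le> part_at xs n \<longleftrightarrow> n < length xs"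
    using part_at_pos_iff [OF assms, of n] by (simp add: Suc_le_eq)
  also have "(\<forall>j<n. Suc n - j \<le> part_at xs j) \<longleftrightarrow> has_staircase n (del_column xs)"
    unfolding has_staircase_def part_at_del_column [OF assms]
    \<comment> \<open>For \<open>j < n\<close> the bound \<open>Suc n - j\<close> is at least 2, so
      truncation at 0 does no harm.\<close>
    by (intro all_cong1 imp_cong refl) arith
  finally show ?thesis .
qed

lemma not_has_staircase_short: "is_partition xs \<Longrightarrow> length xs \<le> n \<Longrightarrow> \<not> has_staircase (Suc n) xs"
  by (simp add: has_staircase_Suc_iff)

section \<open>Lengthening rows and columns of a staircase\<close>

text \<open>
  \<open>extend k \<alpha> \<beta>\<close> lengthens the columns of \<open>\<rho>\<^sub>k\<close> by \<open>\<alpha>\<close> and its rows by \<open>\<beta>\<close>; the value is meaningful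
  only if \<open>length \<alpha> + length \<beta> \<le> k\<close>.
\<close>

fun extend :: "nat \<Rightarrow> nat list \<Rightarrow> nat list \<Rightarrow> nat list" where
  "extend 0 \<alpha> \<beta> = []"
| "extend (Suc k) (a # \<alpha>) \<beta> = add_column (a + Suc k) (extend k \<alpha> \<beta>)"
| "extend (Suc k) [] (b # \<beta>) = (b + Suc k) # extend k [] \<beta>"
| "extend (Suc k) [] [] = Suc k # extend k [] []"

text \<open>Merges the two row cases: an exhausted \<open>\<beta>\<close> lengthens the row by
  0.\<close>

lemma extend_Nil_Suc:
  "extend (Suc k) [] \<beta> = (part_at \<beta> 0 + Suc k) # extend k [] (tl \<beta>)"
  by (cases \<beta>) auto

text \<open>The claims go through one induction because they feed each other: the length and the
  largest part of the smaller diagram show that the added column is strictly taller, or the added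
  row strictly longer, so one new value appears.\<close>

lemma extend_props:
  assumes "is_partition \<alpha>" "is_partition \<beta>" "length \<alpha> + length \<beta> \<le> k"
  shows "is_partition (extend k \<alpha> \<beta>) \<and> length (extend k \<alpha> \<beta>) = k + part_at \<alpha> 0 \<and>
    part_at (extend k \<alpha> \<beta>) 0 = k + part_at \<beta> 0 \<and>
    weight (extend k \<alpha> \<beta>) = weight \<alpha> + weight \<beta> + (Suc k choose 2) \<and>
    card (set (extend k \<alpha> \<beta>)) = k \<and> \<not> has_staircase (Suc k) (extend k \<alpha> \<beta>)"
  using assms
proof (induction k arbitrary: \<alpha> \<beta>)
  case 0
  then show ?case by (simp add: has_staircase_def numeral_2_eq_2)
next
  case (Suc k)
  have choose: "Suc (Suc k) choose 2 = (Suc k choose 2) + Suc k"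
    by (simp add: numeral_2_eq_2)
  show ?case
  proof (cases \<alpha>)
    case (Cons a \<alpha>')
    let ?\<mu> = "extend k \<alpha>' \<beta>"
    have \<alpha>': "is_partition \<alpha>'" "part_at \<alpha>' 0 \<le> a" "length \<alpha>' + length \<beta> \<le> k"
      using Suc.prems Cons by (auto simp: is_partition_Cons)
    note IH = Suc.IH [OF \<alpha>'(1) Suc.prems(2) \<alpha>'(3)]
    have \<mu>: "is_partition ?\<mu>" and len: "length ?\<mu> < a + Suc k"
      using IH \<alpha>'(2) by auto
    have "part_at (add_column (a + Suc k) ?\<mu>) 0 = Suc k + part_at \<beta> 0"
    proof (cases ?\<mu>)
      case Nil
      \<comment> \<open>An empty \<open>?\<mu>\<close> forces \<open>k = 0\<close>, and the new
        first row is a single point.\<close>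
      then have "k = 0" "\<beta> = []" using IH \<alpha>'(3) by auto
      then show ?thesis using Nil by (simp add: add_column_def)
    next
      case (Cons y ys)
      then show ?thesis using IH by (simp add: add_column_def)
    qed
    then show ?thesis
      using IH Cons len choose
      by (simp add: is_partition_add_column length_add_column weight_add_column
          card_set_add_column has_staircase_Suc_iff [of "add_column _ _"] del_column_add_column)
  next
    case Nil
    let ?\<mu> = "extend k [] (tl \<beta>)" and ?x = "part_at \<beta> 0 + Suc k"
    have \<beta>': "is_partition (tl \<beta>)" "part_at (tl \<beta>) 0 \<le> part_at \<beta> 0"
        "length ([] :: nat list) + length (tl \<beta>) \<le> k"
      using Suc.prems by (cases \<beta>; auto simp: is_partition_Cons)+
    note IH = Suc.IH [OF is_partition_Nil \<beta>'(1) \<beta>'(3)]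
    have "part_at ?\<mu> 0 < ?x" using IH \<beta>'(2) by simp
    then have "?x \<notin> set ?\<mu>" "is_partition (?x # ?\<mu>)"
      using IH le_part_at_0 [of ?\<mu> ?x] by (auto simp: is_partition_Cons)
    moreover have "weight \<beta> = part_at \<beta> 0 + weight (tl \<beta>)" by (cases \<beta>) auto
    ultimately show ?thesis
      \<comment> \<open>With no column lengthened there are only \<open>Suc k\<close> rows, too few
        for the larger staircase.\<close>
      using IH choose not_has_staircase_short [of "?x # ?\<mu>" "Suc k"]
      by (simp add: Nil extend_Nil_Suc)
  qed
qed

section \<open>Injectivity and surjectivity of the construction\<close>

text \<open>The length and the largest part of the result reveal the first parts of \<alpha> and
  \<beta>, so both sides come from the same branch of \<open>extend\<close> and lose the same column
  or row.\<close>

lemma extend_inject: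
  assumes "is_partition \<alpha>" "is_partition \<beta>" "length \<alpha> + length \<beta> \<le> k"
    and "is_partition \<alpha>'" "is_partition \<beta>'" "length \<alpha>' + length \<beta>' \<le> k"
    and "extend k \<alpha> \<beta> = extend k \<alpha>' \<beta>'"
  shows "\<alpha> = \<alpha>' \<and> \<beta> = \<beta>'"
  using assms
proof (induction k arbitrary: \<alpha> \<beta> \<alpha>' \<beta>')
  case 0
  then show ?case by simp
next
  case (Suc k)
  note props = extend_props [OF Suc.prems(1-3)] extend_props [OF Suc.prems(4-6)]
  have hd\<alpha>: "part_at \<alpha> 0 = part_at \<alpha>' 0" and hd\<beta>: "part_at \<beta> 0 = part_at \<beta>' 0"
    using props Suc.prems(7) by auto
  show ?case
  proof (cases \<alpha>)
    case (Cons a as)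
    then obtain as' where \<alpha>': "\<alpha>' = a # as'"
      using hd\<alpha> Suc.prems(1) by (cases \<alpha>') (auto simp: is_partition_Cons)
    have parts: "is_partition as" "is_partition as'" "length as + length \<beta> \<le> k"
        "length as' + length \<beta>' \<le> k"
      using Suc.prems Cons \<alpha>' by (auto simp: is_partition_Cons)
    have "is_partition (extend k as \<beta>)" "is_partition (extend k as' \<beta>')"
      using extend_props parts Suc.prems by blast+
    moreover have "add_column (a + Suc k) (extend k as \<beta>) = add_column (a + Suc k) (extend k as' \<beta>')"
      using Suc.prems(7) Cons \<alpha>' by simp
    ultimately have "extend k as \<beta> = extend k as' \<beta>'"
      by (metis del_column_add_column)
    then show ?thesis
      using Suc.IH [of as \<beta> as' \<beta>'] parts Suc.prems Cons \<alpha>' by simp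
  next
    case Nil
    then have \<alpha>': "\<alpha>' = []"
      using hd\<alpha> Suc.prems(4) part_at_0_eq_0_iff by fastforce
    have "is_partition (tl \<beta>)" "is_partition (tl \<beta>')"
      using Suc.prems by (cases \<beta>; cases \<beta>'; auto simp: is_partition_Cons)+
    then have "tl \<beta> = tl \<beta>'"
      using Suc.IH [of "[]" "tl \<beta>" "[]" "tl \<beta>'"] Suc.prems Nil \<alpha>'
      by (simp add: extend_Nil_Suc)
    moreover have "\<beta> = [] \<longleftrightarrow> \<beta>' = []"
      using hd\<beta> Suc.prems part_at_0_eq_0_iff by metis
    ultimately have "\<beta> = \<beta>'"
      using hd\<beta> by (cases \<beta>; cases \<beta>') auto
    then show ?thesis using Nil \<alpha>' by simp
  qed
qed

text \<open>The number of rows tells which branch to invert: more than \<open>k\<close> rows means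
  that a column was added last, exactly \<open>k\<close> rows that a row was.\<close>

lemma extend_surj:
  assumes "is_partition \<mu>" "card (set \<mu>) = k" "\<not> has_staircase (Suc k) \<mu>"
  shows "\<exists>\<alpha> \<beta>. is_partition \<alpha> \<and> is_partition \<beta> \<and> length \<alpha> + length \<beta> \<le> k \<and> extend k \<alpha> \<beta> = \<mu>"
  using assms
proof (induction k arbitrary: \<mu>)
  case 0
  then have "\<mu> = []" by simp
  then show ?case by (intro exI [of _ "[]"]) simp
next
  case (Suc k)
  note \<mu> = Suc.prems(1)
  have "Suc k \<le> length \<mu>" using Suc.prems(2) card_length by metis
  then consider (long) "Suc k < length \<mu>" | (short) "length \<mu> = Suc k" by linarith
  then show ?case
  proof cases
    case long
    define \<mu>' where "\<mu>' = del_column \<mu>"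
    have \<mu>': "is_partition \<mu>'" unfolding \<mu>'_def by (rule is_partition_del_column [OF \<mu>])
    have no_stair: "\<not> has_staircase (Suc k) \<mu>'"
      using Suc.prems(3) has_staircase_Suc_iff [OF \<mu>] long by (simp add: \<mu>'_def)
    \<comment> \<open>Otherwise \<open>\<mu>'\<close> would keep all \<open>Suc k\<close> distinct
      parts and hence contain the staircase excluded by \<open>no_stair\<close>.\<close>
    have one: "1 \<in> set \<mu>"
    proof (rule ccontr)
      assume "1 \<notin> set \<mu>"
      then have "card (set \<mu>') = Suc k"
        using card_set_del_column [OF \<mu>] Suc.prems(2) by (simp add: \<mu>'_def)
      then show False using has_staircase_card_set [OF \<mu>'] no_stair by simp
    qed
    have "card (set \<mu>') = k"
      using card_set_del_column [OF \<mu>] Suc.prems(2) one by (simp add: \<mu>'_def)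
    from Suc.IH [OF \<mu>' this no_stair] obtain \<alpha> \<beta>
      where \<alpha>\<beta>: "is_partition \<alpha>" "is_partition \<beta>" "length \<alpha> + length \<beta> \<le> k" "extend k \<alpha> \<beta> = \<mu>'"
      by blast
    define a where "a = length \<mu> - Suc k"
    have "length \<mu>' < length \<mu>"
      using one by (auto simp: \<mu>'_def del_column_def intro: length_filter_less)
    then have "part_at \<alpha> 0 \<le> a"
      using extend_props [OF \<alpha>\<beta>(1-3)] \<alpha>\<beta>(4) by (simp add: a_def)
    then have "is_partition (a # \<alpha>)" using \<alpha>\<beta>(1) long by (simp add: is_partition_Cons a_def)
    moreover have "extend (Suc k) (a # \<alpha>) \<beta> = \<mu>"
      using add_column_del_column [OF \<mu>] \<alpha>\<beta>(4) long by (simp add: a_def \<mu>'_def del: add_Suc_right)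
    ultimately show ?thesis using \<alpha>\<beta>(2,3) by (intro exI [of _ "a # \<alpha>"] exI [of _ \<beta>]) simp
  next
    case short
    \<comment> \<open>There are as many rows as distinct values, so no part repeats.\<close>
    then have "distinct \<mu>" using Suc.prems(2) card_distinct by metis
    moreover obtain x xs where x: "\<mu> = x # xs" using short by (cases \<mu>) auto
    ultimately have xs: "is_partition xs" "x \<notin> set xs" "card (set xs) = k" "length xs = k"
      using \<mu> Suc.prems(2) short by (auto simp: is_partition_Cons)
    have "part_at xs 0 < x"
      using xs(2) \<mu> x by (cases xs) (auto simp: is_partition_Cons)
    obtain \<alpha> \<beta> where \<alpha>\<beta>: "is_partition \<alpha>" "is_partition \<beta>" "length \<alpha> + length \<beta> \<le> k"
        "extend k \<alpha> \<beta> = xs"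
      using Suc.IH [OF xs(1,3) not_has_staircase_short] xs by auto
    note props = extend_props [OF \<alpha>\<beta>(1-3), unfolded \<alpha>\<beta>(4)]
    \<comment> \<open>The length \<open>k\<close> of \<open>xs\<close> equals
      \<open>k + part_at \<alpha> 0\<close>, so the first part of \<alpha> vanishes.\<close>
    have \<alpha>: "\<alpha> = []" using props xs(4) part_at_0_eq_0_iff [OF \<alpha>\<beta>(1)] by simp
    define b where "b = x - Suc k"
    have b: "x = b + Suc k" "part_at \<beta> 0 \<le> b"
      using props \<open>part_at xs 0 < x\<close> by (auto simp: b_def)
    show ?thesis
    \<comment> \<open>A partition has no part 0, so an unlengthened row needs the branch with both
      lists empty; then \<beta> is already empty, as its first part is at most
      \<open>b\<close>.\<close>
    proof (cases "b = 0")
      case True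
      then have "\<beta> = []" using b(2) part_at_0_eq_0_iff [OF \<alpha>\<beta>(2)] by simp
      then show ?thesis
        using True \<alpha> \<alpha>\<beta>(4) b(1) x by (intro exI [of _ "[]"]) simp
    next
      case False
      then show ?thesis
        using \<alpha> \<alpha>\<beta> b x by (intro exI [of _ "[]"] exI [of _ "b # \<beta>"]) (simp add: is_partition_Cons)
    qed
  qed
qed

theorem theorem2:
  fixes k m :: nat
  shows "card {(\<alpha>, \<beta>). is_partition \<alpha> \<and> is_partition \<beta> \<and>
              weight \<alpha> + weight \<beta> = m \<and> length \<alpha> + length \<beta> \<le> k}
       = card {\<mu>. is_partition \<mu> \<and> weight \<mu> = m + ((k + 1) choose 2) \<and>
              card (corners \<mu>) = k \<and> \<not> diagram (staircase (k + 1)) \<subseteq> diagram \<mu>}"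
    (is "card ?A = card ?B")
proof (rule bij_betw_same_card)
  \<comment> \<open>Corners become distinct parts and containment becomes inequalities, the form in
    which \<open>extend\<close> was analysed.\<close>
  have B: "?B = {\<mu>. is_partition \<mu> \<and> weight \<mu> = m + (Suc k choose 2) \<and>
      card (set \<mu>) = k \<and> \<not> has_staircase (Suc k) \<mu>}"
    by (auto simp: card_corners diagram_staircase_subset_iff)
  show "bij_betw (\<lambda>(\<alpha>, \<beta>). extend k \<alpha> \<beta>) ?A ?B"
    unfolding B bij_betw_def
  proof (intro conjI equalityI subsetI)
    show "inj_on (\<lambda>(\<alpha>, \<beta>). extend k \<alpha> \<beta>) ?A"
      using extend_inject [of _ _ k] by (simp add: inj_on_def split_paired_all) blast
  next
    fix \<mu> assume "\<mu> \<in> (\<lambda>(\<alpha>, \<beta>). extend k \<alpha> \<beta>) ` ?A"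
    then show "\<mu> \<in> {\<mu>. is_partition \<mu> \<and> weight \<mu> = m + (Suc k choose 2) \<and>
        card (set \<mu>) = k \<and> \<not> has_staircase (Suc k) \<mu>}"
      by (auto simp del: binomial_Suc_Suc simp: extend_props)
  next
    fix \<mu> assume \<mu>: "\<mu> \<in> {\<mu>. is_partition \<mu> \<and> weight \<mu> = m + (Suc k choose 2) \<and>
        card (set \<mu>) = k \<and> \<not> has_staircase (Suc k) \<mu>}"
    then obtain \<alpha> \<beta> where \<alpha>\<beta>: "is_partition \<alpha>" "is_partition \<beta>" "length \<alpha> + length \<beta> \<le> k"
        "extend k \<alpha> \<beta> = \<mu>"
      using extend_surj by blast
    \<comment> \<open>Cancelling the staircase weight \<open>Suc k choose 2\<close> leaves total
      weight \<open>m\<close> for the pair.\<close>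
    then have "(\<alpha>, \<beta>) \<in> ?A" using extend_props [OF \<alpha>\<beta>(1-3)] \<mu> by simp
    then show "\<mu> \<in> (\<lambda>(\<alpha>, \<beta>). extend k \<alpha> \<beta>) ` ?A" using \<alpha>\<beta>(4) by force
  qed
qed

end
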